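(* Let $G$ be a finite $d$-regular multigraph with at least two vertices that is not the $2$-vertex $d$-regular multigraph (i.e. $|V(G)|\ne 2$ or $G$ is not two vertices joined by $d$ parallel edges). If $\lambda_2(G) < \frac{3}{4}d$, then $\kappa(G)\ge 2$.
   Context: A multigraph may have multiple edges but has no loops. For vertices $u,v$, $m(u,v)$ is the number of edges with endpoints $u$ and $v$. A multigraph $G$ is $d$-regular if $\sum_{u\in V(G)} m(v,u)=d$ for every vertex $v$. The adjacency matrix of $G$ has $(i,j)$ entry $m(v_i,v_j)$, where $V(G)=\{v_1,\dots,v_n\}$; $\lambda_i(G)$ is its $i$-th largest eigenvalue, counted with multiplicity. $G$ is $k$-vertex-connected if $G$ has more than $k$ vertices and every subgraph obtained by deleting fewer than $k$ vertices is connected; the vertex-connectivity $\kappa(G)$ is the maximum $k$ such that $G$ is $k$-vertex-connected. *)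

theory Defs
  imports "HOL-Library.Multiset" "Jordan_Normal_Form.Char_Poly"
begin

record 'a multigraph =
  verts :: "'a set"
  edges :: "'a set multiset"

definition finite_multigraph :: "'a multigraph \<Rightarrow> bool" where
  "finite_multigraph G \<longleftrightarrow>
     finite (verts G) \<and> (\<forall>e \<in># edges G. e \<subseteq> verts G \<and> card e = 2)"

definition edge_mult :: "'a multigraph \<Rightarrow> 'a \<Rightarrow> 'a \<Rightarrow> nat" where
  "edge_mult G u v = count (edges G) {u, v}"

definition regular :: "'a multigraph \<Rightarrow> nat \<Rightarrow> bool" where
  "regular G d \<longleftrightarrow> (\<forall>v \<in> verts G. (\<Sum>u \<in> verts G. edge_mult G v u) = d)"

(* The enumeration v_1, ..., v_n of the vertices is an arbitrary choice; a different one
   conjugates the adjacency matrix by a permutation matrix. *)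
definition vertex_list :: "'a multigraph \<Rightarrow> 'a list" where
  "vertex_list G = (SOME vs. distinct vs \<and> set vs = verts G)"

definition adjacency_matrix :: "'a multigraph \<Rightarrow> real mat" where
  "adjacency_matrix G =
     (let vs = vertex_list G; n = card (verts G)
      in mat n n (\<lambda>(i, j). real (edge_mult G (vs ! i) (vs ! j))))"

(* proots is the multiset of roots, so each eigenvalue is repeated according to its
   multiplicity; as the matrix is real symmetric, there are card (verts G) of them.
   The index i starts at 1 and is meaningful for 1 \<le> i \<le> card (verts G). *)
definition eigval :: "'a multigraph \<Rightarrow> nat \<Rightarrow> real" where
  "eigval G i =
     rev (sorted_list_of_multiset (proots (char_poly (adjacency_matrix G)))) ! (i - 1)"

definition delete_verts :: "'a multigraph \<Rightarrow> 'a set \<Rightarrow> 'a multigraph" where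
  "delete_verts G S =
     \<lparr>verts = verts G - S, edges = filter_mset (\<lambda>e. e \<inter> S = {}) (edges G)\<rparr>"

definition connected_multigraph :: "'a multigraph \<Rightarrow> bool" where
  "connected_multigraph G \<longleftrightarrow>
     verts G \<noteq> {} \<and>
     (\<forall>u \<in> verts G. \<forall>v \<in> verts G. (u, v) \<in> {(x, y). {x, y} \<in># edges G}\<^sup>*)"

definition vertex_connected :: "nat \<Rightarrow> 'a multigraph \<Rightarrow> bool" where
  "vertex_connected k G \<longleftrightarrow>
     card (verts G) > k \<and>
     (\<forall>S \<subseteq> verts G. card S < k \<longrightarrow> connected_multigraph (delete_verts G S))"

(* For a finite nonempty vertex set the set below is finite and contains 0. *)
definition vertex_connectivity :: "'a multigraph \<Rightarrow> nat" where
  "vertex_connectivity G = Max {k. vertex_connected k G}"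

end

theory Submission
  imports Defs "HOL-Analysis.Function_Topology"
begin

text \<open>
  If a vertex \<open>w\<close> separates \<open>A\<close> from \<open>B\<close> and both sides have at least two vertices, the
  function that is \<open>1\<close> on \<open>A\<close>, \<open>- 1\<close> on \<open>B\<close> and \<open>0\<close> at \<open>w\<close>, centred to have mean zero, has
  Rayleigh quotient at least \<open>3 d / 4\<close>. If one side is a single vertex, that vertex spends all its
  \<open>d\<close> edges on \<open>w\<close>, so \<open>G\<close> is disconnected, and then the centred indicator of a union of
  components has Rayleigh quotient \<open>d\<close>.

  A mean-zero function with Rayleigh quotient at least \<open>c \<le> d\<close> forces \<open>c \<le> \<lambda>\<^sub>2\<close>: adding a multiple
  of the all-ones matrix moves the eigenvalue of the constant vector below \<open>c\<close> and leaves the rest of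
  the characteristic polynomial unchanged, so the largest eigenvalue of the new matrix is a root
  of that remaining factor.
\<close>

section \<open>Rayleigh quotients of symmetric forms on a finite set\<close>

text \<open>A zero \<open>g\<close> of a nonnegative form is a minimum, so the first variation
  vanishes in every direction. In the direction \<open>r\<close>, the image of \<open>g\<close>
  under \<open>L\<close>, that variation is \<open>2 * R\<close>, where \<open>R\<close> is the
  squared norm of \<open>r\<close>.\<close>

lemma psd_kernel_null:
  fixes L :: "'a \<Rightarrow> 'a \<Rightarrow> real"
  assumes fin: "finite V"
    and sym: "\<And>x y. x \<in> V \<Longrightarrow> y \<in> V \<Longrightarrow> L x y = L y x"
    and psd: "\<And>h. 0 \<le> (\<Sum>x\<in>V. \<Sum>y\<in>V. L x y * h x * h y)"
    and null: "(\<Sum>x\<in>V. \<Sum>y\<in>V. L x y * g x * g y) = 0"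
    and x: "x \<in> V"
  shows "(\<Sum>y\<in>V. L x y * g y) = 0"
proof -
  define r where "r = (\<lambda>x. \<Sum>y\<in>V. L x y * g y)"
  define R where "R = (\<Sum>x\<in>V. (r x)\<^sup>2)"
  define D where "D = (\<Sum>x\<in>V. \<Sum>y\<in>V. L x y * r x * r y)"
  have R1: "(\<Sum>x\<in>V. \<Sum>y\<in>V. L x y * r x * g y) = R"
    unfolding R_def power2_eq_square
    by (rule sum.cong[OF refl], subst (2) r_def) (simp add: sum_distrib_left mult_ac)
  have R2: "(\<Sum>x\<in>V. \<Sum>y\<in>V. L x y * g x * r y) = R"
    unfolding R1[symmetric] by (subst sum.swap) (auto intro!: sum.cong simp: sym mult_ac)
  have quad: "0 \<le> 2 * t * R + t\<^sup>2 * D" for t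
  proof -
    have "0 \<le> (\<Sum>x\<in>V. \<Sum>y\<in>V. L x y * (g x + t * r x) * (g y + t * r y))"
      by (rule psd)
    also have "\<dots> = (\<Sum>x\<in>V. \<Sum>y\<in>V. L x y * g x * g y) + t * (\<Sum>x\<in>V. \<Sum>y\<in>V. L x y * g x * r y)
        + t * (\<Sum>x\<in>V. \<Sum>y\<in>V. L x y * r x * g y) + t\<^sup>2 * D"
      unfolding D_def sum_distrib_left sum.distrib[symmetric]
      by (intro sum.cong refl) (simp add: algebra_simps power2_eq_square)
    finally show ?thesis unfolding null R1 R2 by linarith
  qed
  have "R \<ge> 0" unfolding R_def by (simp add: sum_nonneg)
  have "R = 0"
  proof (rule ccontr)
    assume "R \<noteq> 0"
    with \<open>R \<ge> 0\<close> have "R > 0" by simp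
    \<comment> \<open>The choice t = - R / E, with E positive and larger than D, makes the quadratic
      in t negative; no case split on the sign of D is needed.\<close>
    define E where "E = \<bar>D\<bar> + 1"
    have E: "E > 0" "D < E" unfolding E_def by auto
    have "0 \<le> E\<^sup>2 * (2 * (- R / E) * R + (- R / E)\<^sup>2 * D)"
      by (rule mult_nonneg_nonneg[OF _ quad]) simp
    also have "\<dots> = R\<^sup>2 * (D - 2 * E)"
      using E by (simp add: field_simps power2_eq_square)
    finally show False using \<open>R > 0\<close> E by (simp add: zero_le_mult_iff)
  qed
  then show ?thesis
    using x fin by (simp add: R_def sum_nonneg_eq_0_iff r_def)
qed

text \<open>The quadratic form attains its maximum \<mu> on the unit sphere, and a maximiser is an
  eigenvector for \<mu>. Comparison with the normalised \<open>f\<close> gives \<open>c\<close>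
  \<le> \<mu>.\<close>

lemma rayleigh_eigenvector:
  fixes K :: "'a \<Rightarrow> 'a \<Rightarrow> real"
  assumes fin: "finite V"
    and sym: "\<And>x y. x \<in> V \<Longrightarrow> y \<in> V \<Longrightarrow> K x y = K y x"
    and f: "\<exists>x\<in>V. f x \<noteq> 0"
    and le: "c * (\<Sum>x\<in>V. (f x)\<^sup>2) \<le> (\<Sum>x\<in>V. \<Sum>y\<in>V. K x y * f x * f y)"
  obtains \<mu> g where "c \<le> \<mu>" "\<exists>x\<in>V. g x \<noteq> 0" "\<And>x. x \<in> V \<Longrightarrow> (\<Sum>y\<in>V. K x y * g y) = \<mu> * g x"
proof -
  define q where "q = (\<lambda>h. \<Sum>x\<in>V. \<Sum>y\<in>V. K x y * h x * h y)"
  define n where "n = (\<lambda>h. \<Sum>x\<in>V. (h x)\<^sup>2 :: real)"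
  \<comment> \<open>The type of vertices may be infinite, so functions are pinned to 0 outside
    \<open>V\<close>. The box is then compact in the product topology by Tychonoff, and it contains
    every unit vector supported on \<open>V\<close>.\<close>
  define box where "box = PiE UNIV (\<lambda>x. if x \<in> V then {-1..1::real} else {0})"
  define S where "S = box \<inter> {h. n h = 1}"
  have n_pos: "n h > 0" if "\<exists>x\<in>V. h x \<noteq> 0" for h
    using that fin unfolding n_def by (metis sum_pos2 zero_le_power2 zero_less_power2)
  have cont: "continuous_on A n" "continuous_on A q" for A
    unfolding n_def q_def
    by (intro continuous_intros continuous_on_product_then_coordinatewise continuous_on_id)+
  have "compact box"
    using compactin_PiE[of "\<lambda>_. euclidean" UNIV "\<lambda>x. if x \<in> V then {-1..1::real} else {0}"]
    by (simp add: box_def euclidean_product_topology)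
  moreover have "closed {h. n h = 1}"
    using continuous_closed_preimage_constant[OF cont(1)[of UNIV]] by simp
  ultimately have "compact S" unfolding S_def by (rule compact_Int_closed)
  define unit where "unit = (\<lambda>h x. if x \<in> V then h x / sqrt (n h) else 0)"
  have unit: "unit h \<in> S" "q (unit h) = q h / n h" if "\<exists>x\<in>V. h x \<noteq> 0" for h
  proof -
    note pos = n_pos[OF that]
    have "n (unit h) = (\<Sum>x\<in>V. (unit h x)\<^sup>2)"
      by (simp add: n_def)
    also have "\<dots> = (\<Sum>x\<in>V. (h x)\<^sup>2 / n h)"
      using pos by (intro sum.cong) (auto simp: unit_def power_divide)
    also have "\<dots> = 1" using pos by (simp add: sum_divide_distrib[symmetric] n_def)
    finally have 1: "n (unit h) = 1" .
    have "\<bar>unit h x\<bar> \<le> 1" if "x \<in> V" for x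
    proof -
      have "(unit h x)\<^sup>2 \<le> n (unit h)" unfolding n_def using fin that by (intro member_le_sum) auto
      then show ?thesis by (simp add: 1 abs_square_le_1)
    qed
    moreover have unit0: "unit h x = 0" if "x \<notin> V" for x using that by (simp add: unit_def)
    ultimately have "unit h \<in> box" unfolding box_def by (force simp: abs_le_iff unit0)
    with 1 show "unit h \<in> S" by (simp add: S_def)
    have "q (unit h) = (\<Sum>x\<in>V. \<Sum>y\<in>V. K x y * h x * h y / n h)"
      unfolding q_def using pos by (auto intro!: sum.cong simp: unit_def)
    then show "q (unit h) = q h / n h" by (simp add: q_def sum_divide_distrib)
  qed
  from unit(1)[OF f] have "S \<noteq> {}" by auto
  from continuous_attains_sup[OF \<open>compact S\<close> this cont(2)]
  obtain g where g: "g \<in> S" and max: "\<And>h. h \<in> S \<Longrightarrow> q h \<le> q g" by blast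
  have bound: "q h \<le> q g * n h" for h
  proof (cases "\<exists>x\<in>V. h x \<noteq> 0")
    case True
    show ?thesis using max[OF unit(1)[OF True]] n_pos[OF True] unit(2)[OF True]
      by (simp add: field_simps)
  next
    case False
    then show ?thesis by (simp add: q_def n_def)
  qed
  define \<mu> where "\<mu> = q g"
  have "n g = 1" using g by (simp add: S_def)
  \<comment> \<open>\<open>L\<close> represents \<mu> I - K. Its form is nonnegative because \<mu>
    is the maximum, and it vanishes at \<open>g\<close>, so \<open>g\<close> lies in its
    kernel.\<close>
  define L where "L = (\<lambda>x y. (if x = y then \<mu> else 0) - K x y)"
  have L1: "(\<Sum>y\<in>V. L x y * h y) = \<mu> * h x - (\<Sum>y\<in>V. K x y * h y)" if "x \<in> V" for h x
    using fin that by (simp add: L_def left_diff_distrib sum_subtractf if_distrib[of "\<lambda>z. z * _"]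
        sum.delta cong: if_cong)
  have L2: "(\<Sum>x\<in>V. \<Sum>y\<in>V. L x y * h x * h y) = \<mu> * n h - q h" for h
  proof -
    have "(\<Sum>x\<in>V. \<Sum>y\<in>V. L x y * h x * h y) = (\<Sum>x\<in>V. h x * (\<Sum>y\<in>V. L x y * h y))"
      by (simp add: sum_distrib_left mult_ac)
    also have "\<dots> = (\<Sum>x\<in>V. h x * (\<mu> * h x - (\<Sum>y\<in>V. K x y * h y)))"
      by (intro sum.cong refl) (simp add: L1)
    also have "\<dots> = \<mu> * n h - q h"
      by (simp add: n_def q_def right_diff_distrib sum_subtractf sum_distrib_left mult_ac power2_eq_square)
    finally show ?thesis .
  qed
  have "(\<Sum>y\<in>V. L x y * g y) = 0" if "x \<in> V" for x
  proof (rule psd_kernel_null[OF fin _ _ _ that])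
    show "L x y = L y x" if "x \<in> V" "y \<in> V" for x y using sym that by (auto simp: L_def)
    show "0 \<le> (\<Sum>x\<in>V. \<Sum>y\<in>V. L x y * h x * h y)" for h using bound by (simp add: L2 \<mu>_def)
    show "(\<Sum>x\<in>V. \<Sum>y\<in>V. L x y * g x * g y) = 0" using \<open>n g = 1\<close> by (simp add: L2 \<mu>_def)
  qed
  then have "(\<Sum>y\<in>V. K x y * g y) = \<mu> * g x" if "x \<in> V" for x using that by (simp add: L1)
  moreover have "\<exists>x\<in>V. g x \<noteq> 0" using \<open>n g = 1\<close> by (intro ccontr[of "\<exists>x\<in>V. g x \<noteq> 0"]) (simp add: n_def)
  moreover have "c \<le> \<mu>"
  proof -
    have "c * n f \<le> \<mu> * n f" using le bound[of f] by (simp add: \<mu>_def n_def q_def)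
    then show ?thesis using n_pos[OF f] by simp
  qed
  ultimately show thesis using that by blast
qed

section \<open>Characteristic polynomials of matrices with constant row sums\<close>

text \<open>The all-ones vector is an eigenvector for \<open>d\<close>, and the second factor
  belongs to the induced action modulo constants. Its entries are differences within a column, so
  adding one constant to all entries of \<open>A\<close> does not change it.\<close>

lemma char_poly_const_row_sum:
  fixes A :: "'a :: comm_ring_1 mat"
  assumes A: "A \<in> carrier_mat (Suc k) (Suc k)"
    and rows: "\<And>i. i < Suc k \<Longrightarrow> (\<Sum>j<Suc k. A $$ (i, j)) = d"
  shows "char_poly A = [:- d, 1:] * char_poly (mat k k (\<lambda>(i, j). A $$ (Suc i, Suc j) - A $$ (0, Suc j)))"
    (is "_ = _ * char_poly ?M")
proof -
  let ?n = "Suc k"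
  \<comment> \<open>the change of basis that replaces the first unit vector by the all-ones vector, and its inverse\<close>
  define P :: "'a mat" where "P = mat ?n ?n (\<lambda>(i, j). if j = 0 \<or> i = j then 1 else 0)"
  define Q :: "'a mat" where "Q = mat ?n ?n (\<lambda>(i, j). if i = j then 1 else if j = 0 then - 1 else 0)"
  \<comment> \<open>\<open>B\<close> is \<open>A\<close> written in the new basis. Its first column
    says that the all-ones vector is mapped to \<open>d\<close> times itself.\<close>
  define B where "B = four_block_mat (mat 1 1 (\<lambda>_. d)) (mat 1 k (\<lambda>(i, j). A $$ (0, Suc j))) (0\<^sub>m k 1) ?M"
  have carr: "P \<in> carrier_mat ?n ?n" "Q \<in> carrier_mat ?n ?n" "B \<in> carrier_mat ?n ?n"
    by (auto simp: P_def Q_def B_def intro!: carrier_matI)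
  have B: "B $$ (i, j) = (if i = 0 then if j = 0 then d else A $$ (0, j)
      else if j = 0 then 0 else A $$ (i, j) - A $$ (0, j))" if "i < ?n" "j < ?n" for i j
    using that by (auto simp: B_def)
  have prod: "(X * Y) $$ (i, j) = (\<Sum>l<?n. X $$ (i, l) * Y $$ (l, j))"
    if "X \<in> carrier_mat ?n ?n" "Y \<in> carrier_mat ?n ?n" "i < ?n" "j < ?n" for X Y :: "'a mat" and i j
    using that by (auto simp: scalar_prod_def atLeast0LessThan intro!: sum.cong)
  have P_row: "(\<Sum>l<?n. P $$ (i, l) * x l) = (if i = 0 then x 0 else x 0 + x i)" if "i < ?n" for x i
  proof -
    \<comment> \<open>The condition \<open>i \<noteq> 0\<close> keeps the corner entry from being
      counted twice.\<close>
    have "(\<Sum>l<?n. P $$ (i, l) * x l) = (\<Sum>l<?n. (if l = 0 then x l else 0) + (if l = i \<and> i \<noteq> 0 then x l else 0))"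
      using that by (intro sum.cong) (auto simp: P_def)
    also have "\<dots> = (if i = 0 then x 0 else x 0 + x i)"
      using that by (cases "i = 0") (simp_all add: sum.distrib sum.delta)
    finally show ?thesis .
  qed
  have Q_row: "(\<Sum>l<?n. Q $$ (i, l) * x l) = (if i = 0 then x 0 else x i - x 0)" if "i < ?n" for x i
  proof -
    have "(\<Sum>l<?n. Q $$ (i, l) * x l) = (\<Sum>l<?n. (if l = i then x l else 0) - (if l = 0 \<and> i \<noteq> 0 then x l else 0))"
      using that by (intro sum.cong) (auto simp: Q_def)
    also have "\<dots> = (if i = 0 then x 0 else x i - x 0)"
      using that by (cases "i = 0") (simp_all add: sum_subtractf sum.delta)
    finally show ?thesis .
  qed
  have PQ: "P * Q = 1\<^sub>m ?n"
    by (rule eq_matI) (use carr in \<open>auto simp: prod[OF carr(1,2)] P_row simp del: index_mult_mat(1) sum.lessThan_Suc\<close>,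
      auto simp: Q_def)
  have QP: "Q * P = 1\<^sub>m ?n"
    by (rule eq_matI) (use carr in \<open>auto simp: prod[OF carr(2,1)] Q_row simp del: index_mult_mat(1) sum.lessThan_Suc\<close>,
      auto simp: P_def)
  have AP: "A * P = P * B"
  proof (rule eq_matI)
    fix i j assume "i < dim_row (P * B)" "j < dim_col (P * B)"
    then have ij: "i < ?n" "j < ?n" using carr by auto
    have "(A * P) $$ (i, j) = (if j = 0 then d else A $$ (i, j))"
    proof (cases "j = 0")
      case True
      then show ?thesis unfolding prod[OF A carr(1) ij] using ij rows[of i]
        by (simp add: P_def del: sum.lessThan_Suc)
    next
      case False
      then have "(\<Sum>l<?n. A $$ (i, l) * P $$ (l, j)) = (\<Sum>l<?n. if l = j then A $$ (i, l) else 0)"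
        using ij by (intro sum.cong) (auto simp: P_def)
      then show ?thesis unfolding prod[OF A carr(1) ij] using ij False by (simp del: sum.lessThan_Suc)
    qed
    also have "\<dots> = (P * B) $$ (i, j)"
      unfolding prod[OF carr(1,3) ij] P_row[OF ij(1)] using ij by (auto simp: B)
    finally show "(A * P) $$ (i, j) = (P * B) $$ (i, j)" .
  qed (use A carr in auto)
  have "A = A * (P * Q)" using A by (simp add: PQ)
  also have "\<dots> = P * B * Q" unfolding assoc_mult_mat[OF A carr(1,2), symmetric] AP ..
  finally have "similar_mat_wit A B P Q"
    using A carr PQ QP by (simp add: similar_mat_wit_def)
  then have "char_poly A = char_poly B" by (intro char_poly_similar) (unfold similar_mat_def, blast)
  also have "\<dots> = char_poly (mat 1 1 (\<lambda>_. d)) * char_poly ?M"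
    unfolding B_def by (rule char_poly_four_block_zeros_col) auto
  also have "char_poly (mat 1 1 (\<lambda>_. d)) = [:- d, 1:]"
    by (subst char_poly_upper_triangular[of _ 1]) (auto simp: upper_triangular_def diag_mat_def)
  finally show ?thesis .
qed

text \<open>Adding a constant to all entries changes neither the form at the mean-zero
  \<open>f\<close> nor the second factor of the characteristic polynomial, but moves the eigenvalue
  of the constants below \<open>c\<close>. The conclusion is a multiset inclusion so that it also
  records a double root when \<mu> = d.\<close>

lemma two_proots_const_row_sum:
  fixes A :: "real mat"
  assumes A: "A \<in> carrier_mat n n"
    and sym: "\<And>i j. i < n \<Longrightarrow> j < n \<Longrightarrow> A $$ (i, j) = A $$ (j, i)"
    and rows: "\<And>i. i < n \<Longrightarrow> (\<Sum>j<n. A $$ (i, j)) = d"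
    and "c \<le> d"
    and f: "\<exists>i<n. f i \<noteq> 0" "(\<Sum>i<n. f i) = 0"
    and le: "c * (\<Sum>i<n. (f i)\<^sup>2) \<le> (\<Sum>i<n. \<Sum>j<n. A $$ (i, j) * f i * f j)"
  obtains \<mu> where "c \<le> \<mu>" "{#d, \<mu>#} \<subseteq># proots (char_poly A)"
proof -
  obtain k where n: "n = Suc k" using f(1) by (cases n) auto
  \<comment> \<open>Chosen so that every row sum becomes d + n s = c - 1, strictly below
    \<open>c\<close>.\<close>
  define s where "s = (c - 1 - d) / n"
  define C where "C = mat n n (\<lambda>(i, j). A $$ (i, j) + s)"
  define M where "M = mat k k (\<lambda>(i, j). A $$ (Suc i, Suc j) - A $$ (0, Suc j))"
  have C: "C \<in> carrier_mat n n" by (simp add: C_def)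
  have "char_poly C = [:- (c - 1), 1:] * char_poly (mat k k (\<lambda>(i, j). C $$ (Suc i, Suc j) - C $$ (0, Suc j)))"
  proof (rule char_poly_const_row_sum)
    show "C \<in> carrier_mat (Suc k) (Suc k)" using C n by simp
    fix i assume i: "i < Suc k"
    then have "(\<Sum>j<n. C $$ (i, j)) = (\<Sum>j<n. A $$ (i, j)) + n * s"
      by (simp add: C_def n sum.distrib del: sum.lessThan_Suc)
    also have "\<dots> = c - 1" using rows[of i] i by (simp add: n s_def)
    finally show "(\<Sum>j<Suc k. C $$ (i, j)) = c - 1" by (simp add: n)
  qed
  also have "mat k k (\<lambda>(i, j). C $$ (Suc i, Suc j) - C $$ (0, Suc j)) = M"
    by (rule eq_matI) (auto simp: M_def C_def n)
  finally have char_C: "char_poly C = [:- (c - 1), 1:] * char_poly M" .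
  have char_A: "char_poly A = [:- d, 1:] * char_poly M"
    unfolding M_def using char_poly_const_row_sum[of A k d] A rows n by auto
  \<comment> \<open>The shift contributes s times the square of the sum of \<open>f\<close>, which
    is 0.\<close>
  have C_form: "(\<Sum>i<n. \<Sum>j<n. C $$ (i, j) * f i * f j) = (\<Sum>i<n. \<Sum>j<n. A $$ (i, j) * f i * f j)"
  proof -
    have "(\<Sum>i<n. \<Sum>j<n. C $$ (i, j) * f i * f j)
        = (\<Sum>i<n. \<Sum>j<n. A $$ (i, j) * f i * f j) + (\<Sum>i<n. s * f i * (\<Sum>j<n. f j))"
      unfolding sum_distrib_left sum.distrib[symmetric]
      by (intro sum.cong refl) (simp add: C_def algebra_simps)
    then show ?thesis by (simp add: f(2))
  qed
  obtain \<mu> g where \<mu>: "c \<le> \<mu>" and g: "\<exists>i<n. g i \<noteq> 0"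
    and eig: "\<And>i. i < n \<Longrightarrow> (\<Sum>j<n. C $$ (i, j) * g j) = \<mu> * g i"
  proof (rule rayleigh_eigenvector[of "{..<n}" "\<lambda>i j. C $$ (i, j)" f c])
    show "C $$ (i, j) = C $$ (j, i)" if "i \<in> {..<n}" "j \<in> {..<n}" for i j
      using that sym by (auto simp: C_def)
    show "c * (\<Sum>i<n. (f i)\<^sup>2) \<le> (\<Sum>i<n. \<Sum>j<n. C $$ (i, j) * f i * f j)"
      using le by (simp add: C_form)
  qed (use f(1) in auto)
  have "eigenvector C (vec n g) \<mu>"
    unfolding eigenvector_def
  proof (intro conjI)
    show "vec n g \<noteq> 0\<^sub>v (dim_row C)"
    proof
      assume *: "vec n g = 0\<^sub>v (dim_row C)"
      from g obtain i where "i < n" "g i \<noteq> 0" by blast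
      then show False using arg_cong[OF *, of "\<lambda>v. v $ i"] C by auto
    qed
    show "C *\<^sub>v vec n g = \<mu> \<cdot>\<^sub>v vec n g"
      by (rule eq_vecI) (use C eig in \<open>auto simp: scalar_prod_def atLeast0LessThan\<close>)
  qed (use C in auto)
  then have "poly (char_poly C) \<mu> = 0"
    using eigenvalue_root_char_poly[OF C] by (auto simp: eigenvalue_def)
  \<comment> \<open>Since \<mu> \<ge> c > c - 1, the linear factor does not vanish at \<mu>.\<close>
  with \<mu> have root: "poly (char_poly M) \<mu> = 0"
    by (auto simp: char_C poly_mult simp del: mult_pCons_left)
  have "char_poly M \<noteq> 0"
    using degree_monic_char_poly[of M k] by (auto simp: M_def)
  with root have "{#d, \<mu>#} \<subseteq># proots (char_poly A)"
    by (simp add: char_A proots_mult del: mult_pCons_left)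
  with \<mu> show thesis by (rule that)
qed

text \<open>If the second entry of the descending list were below \<open>c\<close>, so would be all
  later ones, leaving room for only one element \<ge> c. Position 1 is the second entry, as indexing
  starts at 0.\<close>

lemma second_largest_ge:
  fixes c :: "'a :: linorder"
  assumes "{#a, b#} \<subseteq># X" "c \<le> a" "c \<le> b"
  shows "c \<le> rev (sorted_list_of_multiset X) ! 1"
proof -
  define r where "r = rev (sorted_list_of_multiset X)"
  have X: "mset r = X" and srt: "sorted (rev r)" by (simp_all add: r_def)
  have "2 \<le> size X" using size_mset_mono[OF assms(1)] by simp
  then obtain x y zs where r: "r = x # y # zs"
    using X by (cases r rule: remdups_adj.cases) auto
  have "c \<le> y"
  proof (rule ccontr)
    assume "\<not> c \<le> y"
    with srt have zs: "filter_mset ((\<le>) c) (mset zs) = {#}"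
      by (force simp: r sorted_append filter_mset_eq_conv)
    have "filter_mset ((\<le>) c) X \<subseteq># {#x#}"
      unfolding X[symmetric] r using \<open>\<not> c \<le> y\<close> by (simp add: zs)
    moreover have "{#a, b#} \<subseteq># filter_mset ((\<le>) c) X"
      using multiset_filter_mono[OF assms(1), of "(\<le>) c"] assms(2,3) by simp
    ultimately have "{#a, b#} \<subseteq># {#x#}" by (rule subset_mset.order_trans[rotated])
    from size_mset_mono[OF this] show False by simp
  qed
  then show ?thesis by (simp add: r_def[symmetric] r)
qed

section \<open>Test functions bounding the second eigenvalue of a regular multigraph\<close>

lemma edge_mult_commute: "edge_mult G u v = edge_mult G v u"
  by (simp add: edge_mult_def insert_commute)

lemma edge_mult_self: "finite_multigraph G \<Longrightarrow> edge_mult G v v = 0"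
  by (force simp: edge_mult_def finite_multigraph_def count_eq_zero_iff)

lemma vertex_list_bij:
  assumes "finite (verts G)"
  shows "bij_betw (\<lambda>i. vertex_list G ! i) {..<card (verts G)} (verts G)"
proof -
  have "\<exists>vs. distinct vs \<and> set vs = verts G"
    using finite_distinct_list[OF assms] by blast
  then have "distinct (vertex_list G) \<and> set (vertex_list G) = verts G"
    unfolding vertex_list_def by (rule someI_ex)
  then show ?thesis by (intro bij_betw_nth) (auto simp: distinct_card[symmetric])
qed

text \<open>The left side of \<open>le\<close> is twice the Laplacian form, each edge being counted
  in both orders; the last factor on the right is the squared norm of \<open>f\<close> minus its
  mean. By regularity the inequality says that the centred function has Rayleigh quotient at least
  \<open>c\<close>. It is nonzero because \<open>f\<close> separates \<open>u\<close> from
  \<open>v\<close>.\<close>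

lemma eigval_2_ge_of_test_function:
  fixes f :: "'a \<Rightarrow> real"
  assumes G: "finite_multigraph G" and reg: "regular G d"
    and uv: "u \<in> verts G" "v \<in> verts G" "f u \<noteq> f v"
    and "c \<le> d"
    and le: "(\<Sum>u\<in>verts G. \<Sum>v\<in>verts G. edge_mult G u v * (f u - f v)\<^sup>2)
        \<le> 2 * (d - c) * ((\<Sum>v\<in>verts G. (f v)\<^sup>2) - (\<Sum>v\<in>verts G. f v)\<^sup>2 / card (verts G))"
  shows "c \<le> eigval G 2"
proof -
  let ?V = "verts G" and ?m = "\<lambda>u v. real (edge_mult G u v)"
  let ?n = "card ?V" and ?A = "adjacency_matrix G"
  have fin: "finite ?V" using G by (simp add: finite_multigraph_def)
  have "?n > 0" using fin uv(1) by (auto simp: card_gt_0_iff)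
  define vs where "vs i = vertex_list G ! i" for i
  have bij: "bij_betw vs {..<?n} ?V" unfolding vs_def using vertex_list_bij[OF fin] .
  note re = sum.reindex_bij_betw[OF bij]
  have A: "?A \<in> carrier_mat ?n ?n" by (simp add: adjacency_matrix_def Let_def)
  have A_ij: "?A $$ (i, j) = ?m (vs i) (vs j)" if "i < ?n" "j < ?n" for i j
    using that by (simp add: adjacency_matrix_def Let_def vs_def)
  have vsV: "vs i \<in> ?V" if "i < ?n" for i using bij that by (auto simp: bij_betw_def)
  have deg: "(\<Sum>v\<in>?V. ?m u v) = d" if "u \<in> ?V" for u
    using reg that by (simp add: regular_def flip: of_nat_sum)
  define a where "a = (\<Sum>v\<in>?V. f v) / ?n"
  define h where "h v = f v - a" for v
  have h0: "(\<Sum>v\<in>?V. h v) = 0"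
    using \<open>?n > 0\<close> by (simp add: h_def sum_subtractf a_def)
  have h2: "(\<Sum>v\<in>?V. (h v)\<^sup>2) = (\<Sum>v\<in>?V. (f v)\<^sup>2) - (\<Sum>v\<in>?V. f v)\<^sup>2 / ?n"
  proof -
    have "(\<Sum>v\<in>?V. (h v)\<^sup>2) = (\<Sum>v\<in>?V. (f v)\<^sup>2 - 2 * a * f v + a\<^sup>2)"
      by (simp add: h_def power2_diff algebra_simps)
    also have "\<dots> = (\<Sum>v\<in>?V. (f v)\<^sup>2) - 2 * a * (\<Sum>v\<in>?V. f v) + ?n * a\<^sup>2"
      by (simp add: sum.distrib sum_subtractf sum_distrib_left)
    also have "\<dots> = (\<Sum>v\<in>?V. (f v)\<^sup>2) - (\<Sum>v\<in>?V. f v)\<^sup>2 / ?n"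
      using \<open>?n > 0\<close> by (simp add: a_def field_simps power2_eq_square)
    finally show ?thesis .
  qed
  \<comment> \<open>Centring preserves differences, so the square can be expanded in
    \<open>h\<close>; both pure square terms then collapse to \<open>d\<close> times the squared
    norm.\<close>
  have "(\<Sum>u\<in>?V. \<Sum>v\<in>?V. ?m u v * (f u - f v)\<^sup>2)
      = (\<Sum>u\<in>?V. \<Sum>v\<in>?V. ?m u v * (h u)\<^sup>2) + (\<Sum>u\<in>?V. \<Sum>v\<in>?V. ?m u v * (h v)\<^sup>2)
        - 2 * (\<Sum>u\<in>?V. \<Sum>v\<in>?V. ?m u v * h u * h v)"
    unfolding sum_distrib_left sum.distrib[symmetric] sum_subtractf[symmetric]
    by (intro sum.cong refl) (simp add: h_def power2_eq_square algebra_simps)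
  also have "(\<Sum>u\<in>?V. \<Sum>v\<in>?V. ?m u v * (h v)\<^sup>2) = (\<Sum>u\<in>?V. \<Sum>v\<in>?V. ?m u v * (h u)\<^sup>2)"
    by (subst sum.swap) (simp add: edge_mult_commute)
  also have "(\<Sum>u\<in>?V. \<Sum>v\<in>?V. ?m u v * (h u)\<^sup>2) = d * (\<Sum>u\<in>?V. (h u)\<^sup>2)"
    by (simp add: sum_distrib_right[symmetric] deg sum_distrib_left)
  finally have form: "c * (\<Sum>v\<in>?V. (h v)\<^sup>2) \<le> (\<Sum>u\<in>?V. \<Sum>v\<in>?V. ?m u v * h u * h v)"
    using le unfolding h2[symmetric] by (simp add: algebra_simps)
  obtain \<mu> where "c \<le> \<mu>" "{#real d, \<mu>#} \<subseteq># proots (char_poly ?A)"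
  proof (rule two_proots_const_row_sum[OF A, of d c "\<lambda>i. h (vs i)"])
    show "?A $$ (i, j) = ?A $$ (j, i)" if "i < ?n" "j < ?n" for i j
      using that by (simp add: A_ij edge_mult_commute)
    show "(\<Sum>j<?n. ?A $$ (i, j)) = d" if "i < ?n" for i
      using that re[of "?m (vs i)"] deg[OF vsV[OF that]] by (simp add: A_ij)
    have "h u \<noteq> 0 \<or> h v \<noteq> 0" using uv(3) by (auto simp: h_def)
    then obtain w where "w \<in> vs ` {..<?n}" "h w \<noteq> 0"
      using uv(1,2) bij by (auto simp: bij_betw_def)
    then show "\<exists>i<?n. h (vs i) \<noteq> 0" by blast
    show "(\<Sum>i<?n. h (vs i)) = 0" using re[of h] h0 by simp
    have "(\<Sum>i<?n. \<Sum>j<?n. ?A $$ (i, j) * h (vs i) * h (vs j))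
        = (\<Sum>i<?n. \<Sum>j<?n. ?m (vs i) (vs j) * h (vs i) * h (vs j))"
      by (intro sum.cong refl) (simp add: A_ij)
    also have "\<dots> = (\<Sum>i<?n. \<Sum>v\<in>?V. ?m (vs i) v * h (vs i) * h v)"
      by (intro sum.cong refl re)
    also have "\<dots> = (\<Sum>u\<in>?V. \<Sum>v\<in>?V. ?m u v * h u * h v)"
      by (rule re)
    finally show "c * (\<Sum>i<?n. (h (vs i))\<^sup>2) \<le> (\<Sum>i<?n. \<Sum>j<?n. ?A $$ (i, j) * h (vs i) * h (vs j))"
      using form re[of "\<lambda>v. (h v)\<^sup>2"] by simp
  qed (use \<open>c \<le> d\<close> in auto)
  then show ?thesis
    using second_largest_ge[of "real d" \<mu> "proots (char_poly ?A)" c] \<open>c \<le> d\<close>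
    by (simp add: eigval_def)
qed

text \<open>The indicator of \<open>A\<close> is constant along every edge. With c = d both sides of
  the test inequality are 0, so the norm of the centred indicator need not be computed.\<close>

lemma eigval_2_ge_of_disconnection:
  assumes G: "finite_multigraph G" and reg: "regular G d"
    and V: "verts G = A \<union> B" "A \<inter> B = {}" "A \<noteq> {}" "B \<noteq> {}"
    and sep: "\<And>u v. u \<in> A \<Longrightarrow> v \<in> B \<Longrightarrow> edge_mult G u v = 0"
  shows "d \<le> eigval G 2"
proof -
  obtain u v where uv: "u \<in> A" "v \<in> B" using V by blast
  have 0: "(\<Sum>u\<in>verts G. \<Sum>v\<in>verts G. real (edge_mult G u v) * (indicator A u - indicator A v)\<^sup>2) = 0"
  proof (intro sum.neutral ballI)
    fix u v assume "u \<in> verts G" "v \<in> verts G"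
    then show "real (edge_mult G u v) * (indicator A u - indicator A v)\<^sup>2 = 0"
      using V(1) sep[of u v] sep[of v u] by (auto simp: indicator_def edge_mult_commute[of G u v])
  qed
  have "indicator A u \<noteq> (indicator A v :: real)" using uv V(2) by (auto simp: indicator_def)
  moreover have "u \<in> verts G" "v \<in> verts G" using uv V(1) by auto
  ultimately show ?thesis
    by (intro eigval_2_ge_of_test_function[OF G reg, of u v "indicator A"]) (auto simp: 0)
qed

text \<open>Only the \<open>d\<close> edges at \<open>w\<close> contribute to the Laplacian form,
  each with squared difference 1, while the centred test function has squared norm at least 4. The
  quotient is therefore at least d - d / 4.\<close>

lemma eigval_2_ge_of_cut_vertex:
  assumes G: "finite_multigraph G" and reg: "regular G d"
    and V: "verts G = insert w (A \<union> B)" "A \<inter> B = {}" "w \<notin> A \<union> B"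
    and card: "2 \<le> card A" "2 \<le> card B"
    and sep: "\<And>u v. u \<in> A \<Longrightarrow> v \<in> B \<Longrightarrow> edge_mult G u v = 0"
  shows "3 / 4 * d \<le> eigval G 2"
proof -
  let ?V = "verts G" and ?m = "\<lambda>u v. real (edge_mult G u v)"
  define f :: "'a \<Rightarrow> real" where "f v = indicator A v - indicator B v" for v
  define p q where "p = real (card A)" and "q = real (card B)"
  have pq: "2 \<le> p" "2 \<le> q" using card by (simp_all add: p_def q_def)
  have fin: "finite A" "finite B" "finite ?V" using G V by (auto simp: finite_multigraph_def)
  obtain u v where uv: "u \<in> A" "v \<in> B" using card by fastforce
  have w: "w \<in> ?V" using V(1) by simp
  have f_A: "f x = 1" if "x \<in> A" for x using that V(2) by (auto simp: f_def indicator_def)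
  have f_B: "f x = - 1" if "x \<in> B" for x using that V(2) by (auto simp: f_def indicator_def)
  have f_w: "f w = 0" using V by (auto simp: f_def)
  have sum_V: "(\<Sum>v\<in>?V. F v) = F w + (\<Sum>v\<in>A. F v) + (\<Sum>v\<in>B. F v)" for F :: "'a \<Rightarrow> real"
    using V fin by (simp add: sum.union_disjoint)
  have deg: "(\<Sum>v\<in>?V. ?m w v) = d"
    using reg V by (simp add: regular_def flip: of_nat_sum)
  \<comment> \<open>\<open>f\<close> is constant on each side and no edge joins the sides. At u = v
    = w both summands on the right vanish, as there are no loops.\<close>
  have "(\<Sum>u\<in>?V. \<Sum>v\<in>?V. ?m u v * (f u - f v)\<^sup>2)
      = (\<Sum>u\<in>?V. \<Sum>v\<in>?V. (if u = w then ?m w v else 0) + (if v = w then ?m u w else 0))"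
  proof (intro sum.cong refl)
    fix u v assume "u \<in> ?V" "v \<in> ?V"
    then consider "u = w" "v = w" | "u = w" "v \<in> A \<union> B" "v \<noteq> w" | "v = w" "u \<in> A \<union> B" "u \<noteq> w"
      | "u \<in> A \<union> B" "v \<in> A \<union> B" "u \<noteq> w" "v \<noteq> w" using V by blast
    then show "?m u v * (f u - f v)\<^sup>2 = (if u = w then ?m w v else 0) + (if v = w then ?m u w else 0)"
    proof cases
      case 4
      then show ?thesis using sep[of u v] sep[of v u]
        by (auto simp: f_A f_B edge_mult_commute[of G u v])
    qed (auto simp: f_A f_B f_w edge_mult_self[OF G])
  qed
  also have "\<dots> = (\<Sum>u\<in>?V. \<Sum>v\<in>?V. if u = w then ?m w v else 0)
      + (\<Sum>u\<in>?V. \<Sum>v\<in>?V. if v = w then ?m u w else 0)"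
    by (simp add: sum.distrib)
  also have "(\<Sum>u\<in>?V. \<Sum>v\<in>?V. if u = w then ?m w v else 0) = d"
    by (subst sum.swap) (use w fin(3) deg in simp)
  also have "(\<Sum>u\<in>?V. \<Sum>v\<in>?V. if v = w then ?m u w else 0) = d"
    using w fin(3) deg by (simp add: edge_mult_commute[of G _ w])
  finally have form: "(\<Sum>u\<in>?V. \<Sum>v\<in>?V. ?m u v * (f u - f v)\<^sup>2) = 2 * d" by simp
  have s1: "(\<Sum>v\<in>?V. f v) = p - q" by (simp add: sum_V f_A f_B f_w p_def q_def)
  have s2: "(\<Sum>v\<in>?V. (f v)\<^sup>2) = p + q" by (simp add: sum_V f_A f_B f_w p_def q_def)
  have n: "real (card ?V) = p + q + 1"
    using V fin by (simp add: card_Un_disjoint p_def q_def)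
  have "4 \<le> p + q - (p - q)\<^sup>2 / (p + q + 1)"
  proof -
    \<comment> \<open>Clearing the denominator leaves 4 p q - 3 (p + q) - 4 \<ge> 0, expanded here
      around p = q = 2, where equality holds.\<close>
    have "0 \<le> 4 * ((p - 2) * (q - 2)) + 5 * (p - 2) + 5 * (q - 2)"
      using pq by (intro add_nonneg_nonneg mult_nonneg_nonneg) auto
    then have "4 * (p + q + 1) \<le> (p + q) * (p + q + 1) - (p - q)\<^sup>2"
      by (simp add: algebra_simps power2_eq_square)
    then show ?thesis using pq by (simp add: field_simps)
  qed
  from mult_left_mono[OF this, of "d / 2"]
  have "2 * d \<le> 2 * (d - 3 / 4 * d) * (p + q - (p - q)\<^sup>2 / (p + q + 1))" by simp
  moreover have "u \<in> ?V" "v \<in> ?V" "f u \<noteq> f v" using uv V(1) by (auto simp: f_A f_B)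
  ultimately show ?thesis
    by (intro eigval_2_ge_of_test_function[OF G reg, of u v f]) (simp_all add: form s1 s2 n)
qed

section \<open>Vertex cuts and their sides\<close>

text \<open>\<open>A\<close> collects the vertices reachable from some \<open>u\<close> that fails
  to reach some \<open>v\<close>. Nonemptiness is assumed because an empty multigraph also counts as
  not connected.\<close>

lemma not_connected_partition:
  assumes "\<not> connected_multigraph (delete_verts G S)" "verts G - S \<noteq> {}"
  obtains A B where "verts G - S = A \<union> B" "A \<inter> B = {}" "A \<noteq> {}" "B \<noteq> {}"
    "\<And>u v. u \<in> A \<Longrightarrow> v \<in> B \<Longrightarrow> edge_mult G u v = 0"
proof -
  define R where "R = {(x, y). {x, y} \<in># edges (delete_verts G S)}"
  obtain u v where uv: "u \<in> verts G - S" "v \<in> verts G - S" "(u, v) \<notin> R\<^sup>*"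
    using assms by (auto simp: connected_multigraph_def R_def delete_verts_def)
  define A where "A = {x \<in> verts G - S. (u, x) \<in> R\<^sup>*}"
  define B where "B = verts G - S - A"
  show thesis
  proof (rule that[of A B])
    fix x y assume xy: "x \<in> A" "y \<in> B"
    show "edge_mult G x y = 0"
    proof (rule ccontr)
      assume "edge_mult G x y \<noteq> 0"
      \<comment> \<open>Both ends avoid \<open>S\<close>, so the edge survives the deletion.\<close>
      then have "(x, y) \<in> R"
        using xy by (auto simp: edge_mult_def R_def delete_verts_def A_def B_def)
      then have "y \<in> A" using xy by (auto simp: A_def B_def intro: rtrancl_into_rtrancl)
      then show False using xy by (simp add: B_def)
    qed
  qed (use uv in \<open>auto simp: A_def B_def\<close>)
qed

text \<open>A one-vertex side \<open>{a}\<close> sends all \<open>d\<close> edges to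
  \<open>w\<close> and exhausts the degree of \<open>w\<close>; then no edge leaves
  \<open>{w, a}\<close>, which forces the second eigenvalue up to \<open>d\<close>.\<close>

lemma cut_vertex_side_card:
  assumes G: "finite_multigraph G" and reg: "regular G d" and lt: "eigval G 2 < d"
    and V: "verts G = insert w (A \<union> B)" "A \<inter> B = {}" "w \<notin> A \<union> B" "A \<noteq> {}" "B \<noteq> {}"
    and sep: "\<And>u v. u \<in> A \<Longrightarrow> v \<in> B \<Longrightarrow> edge_mult G u v = 0"
  shows "2 \<le> card A"
proof (rule ccontr)
  have fin: "finite A" "finite B" "finite (verts G)" using G V by (auto simp: finite_multigraph_def)
  assume "\<not> 2 \<le> card A"
  moreover have "card A \<noteq> 0" using V fin by simp
  ultimately have "card A = 1" by linarith
  then obtain a where A: "A = {a}" by (auto simp: card_1_singleton_iff)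
  have sum_V: "(\<Sum>v\<in>verts G. F v) = F w + F a + (\<Sum>v\<in>B. F v)" for F :: "'a \<Rightarrow> nat"
    using V fin by (simp add: A)
  have "(\<Sum>v\<in>verts G. edge_mult G a v) = d" using reg V by (simp add: regular_def A)
  then have "edge_mult G a w = d"
    using sep by (simp add: sum_V A edge_mult_self[OF G])
  moreover have "(\<Sum>v\<in>verts G. edge_mult G w v) = d" using reg V by (simp add: regular_def)
  ultimately have "(\<Sum>v\<in>B. edge_mult G w v) = 0"
    by (simp add: sum_V edge_mult_commute[of G w a])
  then have "edge_mult G u v = 0" if "u \<in> {w, a}" "v \<in> B" for u v
    using that sep fin by (auto simp: A)
  then have "d \<le> eigval G 2"
    by (intro eigval_2_ge_of_disconnection[OF G reg, of "{w, a}" B]) (use V A in auto)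
  with lt show False by simp
qed

section \<open>Vertex-connectivity from the eigenvalue bound\<close>

theorem theorem1p6:
  fixes G :: "'a multigraph" and d :: nat
  assumes "finite_multigraph G"
    and "regular G d"
    and "card (verts G) \<ge> 2"
    and "\<not> (\<exists>u v. u \<noteq> v \<and> verts G = {u, v} \<and> edges G = replicate_mset d {u, v})"
    and "eigval G 2 < 3 / 4 * real d"
  shows "vertex_connectivity G \<ge> 2"
proof -
  note G = assms(1) and reg = assms(2) and lt = assms(5)
  have fin: "finite (verts G)" using G by (simp add: finite_multigraph_def)
  have lt': "eigval G 2 < d" using lt by simp
  \<comment> \<open>Being 2-vertex-connected requires more than two vertices. On two vertices,
    regularity forces \<open>d\<close> parallel edges, the excluded multigraph.\<close>
  have "card (verts G) \<noteq> 2"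
  proof
    assume "card (verts G) = 2"
    then obtain u v where uv: "verts G = {u, v}" "u \<noteq> v" by (auto simp: card_2_iff)
    have "e = {u, v}" if "e \<in># edges G" for e
      using G that uv by (intro card_subset_eq) (auto simp: finite_multigraph_def)
    then have "edges G = replicate_mset (size (edges G)) {u, v}"
      by (intro set_mset_subset_singletonD) auto
    moreover have "count (edges G) {u, v} = d"
      using reg uv edge_mult_self[OF G, of u] by (auto simp: regular_def edge_mult_def)
    ultimately have "edges G = replicate_mset d {u, v}" by (metis count_replicate_mset)
    with uv assms(4) show False by blast
  qed
  with assms(3) have n3: "card (verts G) > 2" by simp
  have "connected_multigraph (delete_verts G S)" if S: "S \<subseteq> verts G" "card S < 2" for S
  proof (rule ccontr)
    assume "\<not> connected_multigraph (delete_verts G S)"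
    moreover have "verts G - S \<noteq> {}"
      using S n3 card_mono[of S "verts G"] finite_subset[OF S(1) fin] by auto
    ultimately obtain A B where AB: "verts G - S = A \<union> B" "A \<inter> B = {}" "A \<noteq> {}" "B \<noteq> {}"
      and sep: "\<And>u v. u \<in> A \<Longrightarrow> v \<in> B \<Longrightarrow> edge_mult G u v = 0"
      by (rule not_connected_partition) blast
    have sep': "edge_mult G v u = 0" if "u \<in> A" "v \<in> B" for u v
      using sep[OF that] by (simp add: edge_mult_commute)
    have "card S = 0 \<or> card S = 1" using S by auto
    then show False
    proof
      assume "card S = 0"
      then have "S = {}" using finite_subset[OF S(1) fin] by simp
      then have "d \<le> eigval G 2"
        using AB sep by (intro eigval_2_ge_of_disconnection[OF G reg, of A B]) auto
      with lt' show False by simp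
    next
      assume "card S = 1"
      then obtain w where "S = {w}" by (auto simp: card_1_singleton_iff)
      then have V: "verts G = insert w (A \<union> B)" "w \<notin> A \<union> B"
        using S AB(1) by auto
      have "2 \<le> card A"
        by (rule cut_vertex_side_card[OF G reg lt' V(1) AB(2) V(2) AB(3,4) sep])
      moreover have "2 \<le> card B"
        by (rule cut_vertex_side_card[OF G reg lt', of w B A]) (use V AB sep' in auto)
      ultimately have "3 / 4 * d \<le> eigval G 2"
        by (rule eigval_2_ge_of_cut_vertex[OF G reg V(1) AB(2) V(2) _ _ sep])
      with lt show False by simp
    qed
  qed
  with n3 have "vertex_connected 2 G" by (simp add: vertex_connected_def)
  \<comment> \<open>The maximum dominates the member 2 only because the set is finite; its members
    are bounded by the number of vertices.\<close>
  moreover have "finite {k. vertex_connected k G}"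
    by (rule finite_subset[of _ "{..card (verts G)}"]) (auto simp: vertex_connected_def)
  ultimately show ?thesis unfolding vertex_connectivity_def by (intro Max_ge) auto
qed

end
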